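(* Let $f(x)\in \mathbb{Z}[x]$ be a polynomial of degree $d\geq 2$ with positive leading coefficient and having at least two distinct roots over an algebraic closure $\overline{\mathbb{Q}}$ of $\mathbb{Q}$, let $m\in \mathbb{Z}_{\geq 2}$, and put $F(x)=f(x)^m$. Then the set of lattice points in $\mathbb{Z}_{>0}\times\mathbb{Z}_{>0}$ that are visible along $F(x)$ has density $1$, i.e. $$D(F)=\lim_{N\to\infty}\frac{\#\{(a,h)\in\mathbb{Z}_{>0}^2:\max\{a,h\}\le N \text{ and } (a,h) \text{ is visible along } F\}}{N^2}=1.$$
   Context: For $F(x)\in\mathbb{Z}[x]$ with positive leading coefficient, a lattice point $(a,h)\in\mathbb{Z}_{>0}\times\mathbb{Z}_{>0}$ is called visible along $F(x)$ if there exists a rational number $t\in\mathbb{Q}$ such that $h=t\,F(a)$ and $a$ is the smallest positive integer $u$ such that $t\,F(u)$ is a positive integer; otherwise it is called invisible along $F(x)$. *)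

theory Defs
  imports
    Complex_Main
    "HOL-Computational_Algebra.Polynomial"
    "HOL-Algebra.Algebraic_Closure_Type"
begin

definition pos_int_value :: "int poly \<Rightarrow> rat \<Rightarrow> int \<Rightarrow> bool" where
  "pos_int_value F t u \<longleftrightarrow> t * of_int (poly F u) \<in> \<int> \<and> t * of_int (poly F u) > 0"

definition visible_along :: "int poly \<Rightarrow> int \<times> int \<Rightarrow> bool" where
  "visible_along F = (\<lambda>(a, h). a > 0 \<and> h > 0 \<and>
     (\<exists>t :: rat. of_int h = t * of_int (poly F a) \<and>
        pos_int_value F t a \<and> (\<forall>u. u > 0 \<and> pos_int_value F t u \<longrightarrow> a \<le> u)))"

definition has_lattice_density :: "(int \<times> int) set \<Rightarrow> real \<Rightarrow> bool" where
  "has_lattice_density S D \<longleftrightarrow>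
     (\<lambda>N :: nat. real (card {(a, h). a > 0 \<and> h > 0 \<and> max a h \<le> int N \<and> (a, h) \<in> S}) / real N ^ 2)
       \<longlonglongrightarrow> D"

end

theory Submission
  imports Defs
begin

text \<open>
  If \<open>(a, h)\<close> is invisible along \<open>f\<^sup>m\<close> and \<open>a\<close> is large, some \<open>0 < b < a\<close> has \<open>f(b)/f(a) = p/q\<close>
  in lowest terms with \<open>0 < |p| < q\<close>, and \<open>q\<^sup>m\<close> divides \<open>h\<close>. Since \<open>m \<ge> 2\<close>, the points with
  \<open>q > Q\<close> number at most \<open>N\<^sup>2 / Q\<close>. For each of the finitely many remaining ratios \<open>c = p/q\<close>
  the integers \<open>a\<close> for which \<open>f(b) = c f(a)\<close> is solvable have density zero: a solution satisfies
  \<open>b = \<gamma> a + \<delta> + o(1)\<close> with \<open>\<gamma>\<^sup>d = c\<close>, so if some gap \<open>k\<close> between such \<open>a\<close> occurs infinitely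
  often, then \<open>\<gamma> k\<close> and \<open>\<delta> k\<close> are integers, \<open>b = \<gamma> a + \<delta>\<close> holds exactly, and hence
  \<open>f(\<gamma> x + \<delta>) = c f(x)\<close> identically. The finite root set of \<open>f\<close> is then stable under an affine
  contraction, which forces a single root.
\<close>

section \<open>Growth and asymptotics of real polynomials\<close>

lemma poly_map_of_int:
  "poly (map_poly of_int p) (of_int x) = (of_int (poly p x) :: 'a :: comm_ring_1)"
  by (induction p) (simp_all add: map_poly_pCons)

text \<open>Binomial expansion of each power of the linear polynomial. Terms with
  \<open>i < k\<close> may stay in the sum: the truncated \<open>i - k\<close> does no harm there,
  since \<open>i choose k\<close> is zero.\<close>

lemma coeff_pcompose_linear:
  fixes p :: "'a :: comm_semiring_1 poly"
  shows "Polynomial.coeff (pcompose p [:u, v:]) k =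
    (\<Sum>i\<le>Polynomial.degree p. Polynomial.coeff p i * (of_nat (i choose k) * v ^ k * u ^ (i - k)))"
proof -
  have pw: "Polynomial.coeff ([:u, v:] ^ i) k = of_nat (i choose k) * v ^ k * u ^ (i - k)" for i
  proof (cases "k \<le> i")
    case True
    then show ?thesis by (rule coeff_linear_poly_power)
  next
    case False
    have "Polynomial.degree ([:u, v:] ^ i) \<le> Polynomial.degree [:u, v:] * i"
      by (rule degree_power_le)
    also have "\<dots> \<le> i" by simp
    finally have "Polynomial.degree ([:u, v:] ^ i) < k" using False by linarith
    then show ?thesis using False by (simp add: coeff_eq_0 binomial_eq_0)
  qed
  have "pcompose p [:u, v:] =
      (\<Sum>i\<le>Polynomial.degree p. smult (Polynomial.coeff p i) ([:u, v:] ^ i))"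
    by (simp add: pcompose_altdef poly_altdef degree_map_poly coeff_map_poly)
  then show ?thesis by (simp add: coeff_sum pw)
qed

lemma eventually_poly_pos:
  fixes p :: "real poly"
  assumes "Polynomial.lead_coeff p > 0"
  shows "eventually (\<lambda>x. poly p x > 0) at_top"
proof -
  obtain n where "\<forall>x\<ge>n. poly p x \<ge> Polynomial.lead_coeff p"
    using poly_pinfty_gt_lc[OF assms] by blast
  then show ?thesis
    using assms unfolding eventually_at_top_linorder by force
qed

text \<open>
  The shift \<open>\<delta>\<close> is chosen so that the two leading coefficients of
  \<open>f(\<gamma>x + \<delta>)\<close> and \<open>\<gamma>\<^sup>d f(x)\<close> agree; perturbing \<open>\<delta>\<close> by \<open>\<epsilon>\<close> then changes
  the coefficient of \<open>x\<^bsup>d-1\<^esup>\<close> by a positive multiple of \<open>\<epsilon>\<close>.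
\<close>
lemma poly_affine_asymptotics:
  fixes p :: "real poly"
  assumes deg: "Polynomial.degree p > 0" and lc: "Polynomial.lead_coeff p > 0" and g: "\<gamma> > 0"
  obtains \<delta> where
    "\<And>\<epsilon>. \<epsilon> > 0 \<Longrightarrow> eventually (\<lambda>x. poly p (\<gamma> * x + \<delta> - \<epsilon>) < \<gamma> ^ Polynomial.degree p * poly p x \<and>
       \<gamma> ^ Polynomial.degree p * poly p x < poly p (\<gamma> * x + \<delta> + \<epsilon>)) at_top"
proof -
  obtain n where n: "Polynomial.degree p = Suc n" using deg by (cases "Polynomial.degree p") auto
  define A where "A = Polynomial.coeff p (Suc n)"
  define B where "B = Polynomial.coeff p n"
  have A: "A > 0" using lc n A_def by simp
  define \<delta> where "\<delta> = (\<gamma> - 1) * B / (real (Suc n) * A)"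
  define P where "P e = pcompose p [:\<delta> + e, \<gamma>:] - smult (\<gamma> ^ Suc n) p" for e
  have poly_P: "poly (P e) x = poly p (\<gamma> * x + \<delta> + e) - \<gamma> ^ Suc n * poly p x" for e x
    by (simp add: P_def poly_pcompose algebra_simps)
  have c1: "Polynomial.coeff (P e) (Suc n) = 0" for e
    by (simp add: P_def coeff_pcompose_linear n binomial_eq_0)
  have c2: "Polynomial.coeff (P e) n = \<gamma> ^ n * (real (Suc n) * A) * e" for e
  proof -
    have "Polynomial.coeff (pcompose p [:\<delta> + e, \<gamma>:]) n
       = (\<Sum>i\<in>{n, Suc n}. Polynomial.coeff p i * (of_nat (i choose n) * \<gamma> ^ n * (\<delta> + e) ^ (i - n)))"
      unfolding coeff_pcompose_linear n
      by (rule sum.mono_neutral_right) auto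
    also have "\<dots> = B * \<gamma> ^ n + A * (real (Suc n) * \<gamma> ^ n * (\<delta> + e))"
      by (simp add: A_def B_def)
    finally have "Polynomial.coeff (P e) n = \<gamma> ^ n * (B * (1 - \<gamma>) + real (Suc n) * A * \<delta> + real (Suc n) * A * e)"
      by (simp add: P_def B_def algebra_simps)
    moreover have "real (Suc n) * A * \<delta> = (\<gamma> - 1) * B"
      using A by (simp add: \<delta>_def)
    then have "B * (1 - \<gamma>) + real (Suc n) * A * \<delta> = 0" by (simp add: algebra_simps)
    ultimately show ?thesis by (simp only: mult.assoc add_0)
  qed
  have "Polynomial.degree (P e) \<le> Suc n" for e
    unfolding P_def
    by (intro degree_diff_le order.trans[OF degree_pcompose_le]) (use n in auto)
  with c1 have dP: "Polynomial.degree (P e) \<le> n" for e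
    by (metis degree_le le_degree le_antisym not_less_eq_eq leading_coeff_0_iff degree_0 le0)
  \<comment> \<open>For \<open>e \<noteq> 0\<close> the coefficient \<open>c2\<close> is the leading
    one, so near infinity \<open>P e\<close> has the sign of \<open>e\<close>.\<close>
  have dP': "Polynomial.degree (P e) = n" if "e \<noteq> 0" for e
    by (rule antisym[OF dP le_degree]) (use A g that in \<open>simp add: c2\<close>)
  show ?thesis
  proof (rule that[of \<delta>])
    fix \<epsilon> :: real assume e: "\<epsilon> > 0"
    have 1: "eventually (\<lambda>x. poly (P \<epsilon>) x > 0) at_top"
      by (rule eventually_poly_pos) (use A g e in \<open>simp add: dP' c2\<close>)
    have 2: "eventually (\<lambda>x. poly (- P (- \<epsilon>)) x > 0) at_top"
      by (rule eventually_poly_pos) (use A g e in \<open>simp add: dP' c2\<close>)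
    show "eventually (\<lambda>x. poly p (\<gamma> * x + \<delta> - \<epsilon>) < \<gamma> ^ Polynomial.degree p * poly p x \<and>
       \<gamma> ^ Polynomial.degree p * poly p x < poly p (\<gamma> * x + \<delta> + \<epsilon>)) at_top"
      using 1 2 by eventually_elim (simp add: poly_P n)
  qed
qed

lemma eventually_poly_gt:
  fixes p :: "real poly"
  assumes "Polynomial.degree p > 0" and "Polynomial.lead_coeff p > 0"
  shows "eventually (\<lambda>x. poly p x > C) at_top"
proof -
  have "Polynomial.lead_coeff (p - [:C:]) > 0 "
    using assms by (cases p rule: pCons_cases) (auto split: if_splits)
  from eventually_poly_pos[OF this] show ?thesis by simp
qed

text \<open>Beyond some \<open>M\<close> both \<open>p\<close> and its derivative are positive, so
  \<open>p\<close> increases there; on \<open>[0, M]\<close> the values are bounded by a constant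
  \<open>C\<close>, which \<open>p y\<close> eventually exceeds.\<close>

lemma eventually_poly_dominates:
  fixes p :: "real poly"
  assumes deg: "Polynomial.degree p > 0" and lc: "Polynomial.lead_coeff p > 0"
  shows "eventually (\<lambda>y. \<forall>x. 0 \<le> x \<and> x < y \<longrightarrow> \<bar>poly p x\<bar> < poly p y) at_top"
proof -
  have "Polynomial.lead_coeff (pderiv p) > 0"
    using deg lc by (simp add: degree_pderiv coeff_pderiv)
  from eventually_poly_pos[OF this] eventually_poly_pos[OF lc]
  have "eventually (\<lambda>x. poly (pderiv p) x > 0 \<and> poly p x > 0) at_top"
    by eventually_elim simp
  then obtain M where M: "\<And>x. x \<ge> M \<Longrightarrow> poly (pderiv p) x > 0 \<and> poly p x > 0"
    unfolding eventually_at_top_linorder by blast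
  obtain C where C: "\<And>x. 0 \<le> x \<Longrightarrow> x \<le> M \<Longrightarrow> \<bar>poly p x\<bar> \<le> C"
  proof (cases "0 \<le> M")
    case True
    have "\<exists>C. \<forall>x. 0 \<le> x \<and> x \<le> M \<longrightarrow> \<bar>poly p x\<bar> \<le> C"
      using True by (intro isCont_bounded) (auto intro!: continuous_intros)
    then show ?thesis using that by blast
  qed (use that in force)
  have "eventually (\<lambda>y. y \<ge> M \<and> poly p y > C) at_top"
    using eventually_ge_at_top[of M] eventually_poly_gt[OF assms, of C] by eventually_elim simp
  then show ?thesis
  proof eventually_elim
    case (elim y)
    show ?case
    proof (intro allI impI)
      fix x assume x: "0 \<le> x \<and> x < y"
      show "\<bar>poly p x\<bar> < poly p y"
      proof (cases "x \<le> M")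
        case True
        then show ?thesis using C[of x] x elim by force
      next
        case False
        obtain z where "x < z" "z < y" "poly p y - poly p x = (y - x) * poly (pderiv p) z"
          using poly_MVT[of x y p] x by blast
        moreover have "(y - x) * poly (pderiv p) z > 0"
          using M[of z] False x \<open>x < z\<close> by simp
        ultimately show ?thesis using M[of x] False by simp
      qed
    qed
  qed
qed

text \<open>With \<open>\<gamma>\<close> the root of \<open>c\<close> of order the degree,
  \<open>c * poly p x\<close> lies strictly between the values of \<open>p\<close> at
  \<open>\<gamma> * x + \<delta> - \<epsilon>\<close> and
  \<open>\<gamma> * x + \<delta> + \<epsilon>\<close>. Domination then keeps any solution
  \<open>y \<ge> 0\<close> between these two points.\<close>

lemma poly_ratio_solutions_asymptotics:
  fixes p :: "real poly"
  assumes deg: "Polynomial.degree p > 0" and lc: "Polynomial.lead_coeff p > 0" and c: "c > 0"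
  obtains \<gamma> \<delta> where "\<gamma> > 0" "\<gamma> ^ Polynomial.degree p = c"
    "\<And>\<epsilon>. \<epsilon> > 0 \<Longrightarrow> eventually (\<lambda>x. \<forall>y\<ge>0. poly p y = c * poly p x \<longrightarrow> \<bar>y - \<gamma> * x - \<delta>\<bar> < \<epsilon>) at_top"
proof -
  define \<gamma> where "\<gamma> = root (Polynomial.degree p) c"
  have g: "\<gamma> > 0" "\<gamma> ^ Polynomial.degree p = c"
    using c deg by (simp_all add: \<gamma>_def)
  obtain \<delta> where *:
    "\<And>\<epsilon>. \<epsilon> > 0 \<Longrightarrow> eventually (\<lambda>x. poly p (\<gamma> * x + \<delta> - \<epsilon>) < c * poly p x \<and>
       c * poly p x < poly p (\<gamma> * x + \<delta> + \<epsilon>)) at_top"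
    using poly_affine_asymptotics[OF deg lc g(1)] unfolding g(2) by blast
  obtain Y where Y: "\<And>x y. y \<ge> Y \<Longrightarrow> 0 \<le> x \<Longrightarrow> x < y \<Longrightarrow> \<bar>poly p x\<bar> < poly p y"
    using eventually_poly_dominates[OF deg lc] unfolding eventually_at_top_linorder by blast
  show ?thesis
  proof (rule that[OF g, of \<delta>])
    fix \<epsilon> :: real assume e: "\<epsilon> > 0"
    \<comment> \<open>The \<open>Y\<close> makes domination available at both endpoints, and the
      \<open>0\<close> is there because domination compares only with nonnegative arguments.\<close>
    have "eventually (\<lambda>x. x \<ge> (max 0 Y + \<epsilon> - \<delta>) / \<gamma>) at_top"
      by (rule eventually_ge_at_top)
    then have "eventually (\<lambda>x. \<gamma> * x + \<delta> - \<epsilon> \<ge> max 0 Y) at_top"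
      by eventually_elim (use g in \<open>simp add: field_simps\<close>)
    with *[OF e] show "eventually (\<lambda>x. \<forall>y\<ge>0. poly p y = c * poly p x \<longrightarrow> \<bar>y - \<gamma> * x - \<delta>\<bar> < \<epsilon>) at_top"
    proof eventually_elim
      case (elim x)
      show ?case
      proof (intro allI impI)
        fix y assume y: "y \<ge> 0" "poly p y = c * poly p x"
        have "\<not> y \<le> \<gamma> * x + \<delta> - \<epsilon>"
          using Y[of "\<gamma> * x + \<delta> - \<epsilon>" y] elim y by (cases "y = \<gamma> * x + \<delta> - \<epsilon>") auto
        moreover have "\<not> y \<ge> \<gamma> * x + \<delta> + \<epsilon>"
          using Y[of y "\<gamma> * x + \<delta> + \<epsilon>"] elim y e by (cases "y = \<gamma> * x + \<delta> + \<epsilon>") auto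
        ultimately show "\<bar>y - \<gamma> * x - \<delta>\<bar> < \<epsilon>" by linarith
      qed
    qed
  qed
qed

section \<open>Affine contractions of root sets and integrality of limits\<close>

text \<open>The iterates \<open>g n\<close> of a root under the map are all roots, and their
  displacement from the fixed point \<open>\<phi>\<close> is scaled by \<open>r ^ n\<close>. Unless
  \<open>x\<close> is the fixed point they are pairwise distinct, which is too many roots. A
  rational \<open>r\<close> gives \<open>0 < r < 1\<close> a meaning over a field without an
  order.\<close>

lemma affine_invariant_poly_root:
  fixes P :: "'a :: field_char_0 poly"
  assumes "P \<noteq> 0" and r: "0 < r" "r < 1"
    and inv: "\<And>x. poly P x = 0 \<Longrightarrow> poly P (of_rat r * x + e) = 0"
    and x: "poly P x = 0"
  shows "x = e / (1 - of_rat r)"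
proof (rule ccontr)
  assume ne: "x \<noteq> e / (1 - of_rat r)"
  define \<phi> where "\<phi> = e / (1 - of_rat r)"
  define g where "g n = \<phi> + of_rat (r ^ n) * (x - \<phi>)" for n :: nat
  have "of_rat r \<noteq> (1 :: 'a)" using r by simp
  then have \<phi>: "of_rat r * \<phi> + e = \<phi>" by (simp add: \<phi>_def field_simps)
  have "poly P (g n) = 0" for n
  proof (induction n)
    case (Suc n)
    have "g (Suc n) = of_rat r * g n + e"
      using \<phi> by (simp add: g_def of_rat_mult algebra_simps)
    with inv[OF Suc] show ?case by simp
  qed (simp add: g_def x)
  then have "range g \<subseteq> {x. poly P x = 0}" by auto
  then have "finite (range g)"
    using poly_roots_finite[OF \<open>P \<noteq> 0\<close>] finite_subset by blast
  moreover have "inj g"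
  proof (rule injI)
    fix m n assume "g m = g n"
    then have "r ^ m = r ^ n" using ne by (simp add: g_def \<phi>_def)
    then show "m = n" using r power_strict_decreasing_iff[of r] by (metis less_irrefl linorder_neqE_nat)
  qed
  ultimately show False using finite_imageD by blast
qed

text \<open>The integers are closed in the reals: a non-integer has positive distance to both
  neighbouring integers. This turns asymptotic estimates into exact integrality.\<close>

lemma approximable_by_int_imp_Ints:
  fixes x :: real
  assumes "\<And>\<epsilon>. \<epsilon> > 0 \<Longrightarrow> \<exists>n :: int. \<bar>real_of_int n - x\<bar> < \<epsilon>"
  shows "\<exists>n :: int. x = of_int n"
proof (rule ccontr)
  assume "\<nexists>n :: int. x = of_int n"
  then have "x \<noteq> of_int \<lfloor>x\<rfloor>" by blast
  then have "min (x - of_int \<lfloor>x\<rfloor>) (of_int \<lfloor>x\<rfloor> + 1 - x) > 0" by linarith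
  from assms[OF this] obtain n :: int where "\<bar>real_of_int n - x\<bar> < min (x - of_int \<lfloor>x\<rfloor>) (of_int \<lfloor>x\<rfloor> + 1 - x)"
    by blast
  then have "of_int \<lfloor>x\<rfloor> < real_of_int n" "real_of_int n < of_int (\<lfloor>x\<rfloor> + 1)" by auto
  then show False unfolding of_int_less_iff by simp
qed

section \<open>Solutions of f(b)/f(a) = p/q for a fixed ratio\<close>

definition ratio_solutions :: "int poly \<Rightarrow> int \<Rightarrow> int \<Rightarrow> int set" where
  "ratio_solutions f p q = {a. a > 0 \<and> (\<exists>b>0. q * poly f b = p * poly f a)}"

text \<open>For large \<open>a\<close> the value \<open>poly f b\<close> would have to be negative,
  which confines \<open>b\<close> to a bounded range and bounds the left side, while
  \<open>poly f a\<close> tends to infinity.\<close>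

lemma finite_ratio_solutions_neg:
  assumes deg: "Polynomial.degree f > 0" and lc: "Polynomial.lead_coeff f > 0"
    and p: "p < 0" and q: "q > 0"
  shows "finite (ratio_solutions f p q)"
proof -
  define g where "g = map_poly real_of_int f"
  have dg: "Polynomial.degree g > 0" "Polynomial.lead_coeff g > 0"
    using deg lc by (simp_all add: g_def degree_map_poly coeff_map_poly)
  have gi: "poly g (of_int x) = of_int (poly f x)" for x
    by (simp add: g_def poly_map_of_int)
  obtain Y where Y: "\<And>x. x \<ge> Y \<Longrightarrow> poly g x > 0"
    using eventually_poly_pos[OF dg(2)] unfolding eventually_at_top_linorder by blast
  define C where "C = (\<Sum>b\<in>{0..\<lceil>Y\<rceil>}. \<bar>poly f b\<bar>)"
  obtain Z where Z: "\<And>x. x \<ge> Z \<Longrightarrow> poly g x > of_int (q * C)"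
    using eventually_poly_gt[OF dg, of "of_int (q * C)"] unfolding eventually_at_top_linorder by blast
  have "a \<le> \<lceil>max Y Z\<rceil>" if ab: "a > 0" "b > 0" "q * poly f b = p * poly f a" for a b
  proof (rule ccontr)
    assume "\<not> a \<le> \<lceil>max Y Z\<rceil>"
    then have a: "real_of_int a \<ge> Y" "real_of_int a \<ge> Z" by linarith+
    have fa: "poly f a > 0" using Y[OF a(1)] gi by simp
    then have "q * poly f b < 0" using ab p by (simp add: mult_neg_pos)
    then have "poly f b < 0" using q by (simp add: mult_less_0_iff)
    then have "\<not> real_of_int b \<ge> Y" using Y[of b] gi by force
    then have "b \<in> {0..\<lceil>Y\<rceil>}" using ab by simp linarith
    then have "\<bar>poly f b\<bar> \<le> C" unfolding C_def
      by (intro member_le_sum) auto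
    then have "q * \<bar>poly f b\<bar> \<le> q * C" using q by simp
    also have "q * C < poly f a" using Z[OF a(2)] gi by (simp flip: of_int_mult)
    also have "poly f a \<le> \<bar>p\<bar> * poly f a"
      using p fa mult_right_mono[of 1 "\<bar>p\<bar>" "poly f a"] by simp
    also have "\<bar>p\<bar> * poly f a = \<bar>q * poly f b\<bar>" using fa ab(3) by (simp add: abs_mult)
    also have "\<dots> = q * \<bar>poly f b\<bar>" using q by (simp add: abs_mult)
    finally show False by simp
  qed
  then have "ratio_solutions f p q \<subseteq> {0..\<lceil>max Y Z\<rceil>}"
    by (auto simp: ratio_solutions_def)
  then show ?thesis using finite_subset by blast
qed

text \<open>The asymptotics live over the reals, whereas the two roots lie in an arbitrary field of
  characteristic zero. The passage between them is possible because an infinite gap set forces both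
  coefficients of the limiting affine map to be rational.\<close>

lemma finite_ratio_solutions_gap:
  fixes f :: "int poly" and x y :: "'a :: field_char_0"
  assumes deg: "Polynomial.degree f > 0" and lc: "Polynomial.lead_coeff f > 0"
    and roots: "x \<noteq> y" "poly (map_poly of_int f) x = 0" "poly (map_poly of_int f) y = 0"
    and p: "p > 0" "p < q" and k: "k > 0"
  shows "finite {a \<in> ratio_solutions f p q. a + k \<in> ratio_solutions f p q}" (is "finite ?T")
proof (rule ccontr)
  assume inf: "infinite ?T"
  define g where "g = map_poly real_of_int f"
  have dg: "Polynomial.degree g > 0" "Polynomial.lead_coeff g > 0"
    using deg lc by (simp_all add: g_def degree_map_poly coeff_map_poly)
  have gi: "poly g (of_int x) = of_int (poly f x)" for x
    by (simp add: g_def poly_map_of_int)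
  obtain \<gamma> \<delta> where \<gamma>: "\<gamma> > 0" "\<gamma> ^ Polynomial.degree g = of_int p / of_int q"
    and ev: "\<And>\<epsilon>. \<epsilon> > 0 \<Longrightarrow> eventually (\<lambda>x. \<forall>y\<ge>0. poly g y = of_int p / of_int q * poly g x \<longrightarrow> \<bar>y - \<gamma> * x - \<delta>\<bar> < \<epsilon>) at_top"
    using poly_ratio_solutions_asymptotics[OF dg, of "of_int p / of_int q"] p by auto
  have \<gamma>1: "\<gamma> < 1"
  proof (rule ccontr)
    assume "\<not> \<gamma> < 1"
    then have "\<gamma> ^ Polynomial.degree g \<ge> 1" by (simp add: one_le_power)
    then show False using \<gamma> p by (simp add: field_simps)
  qed
  have near: "\<exists>A. \<forall>a b. a \<ge> A \<longrightarrow> b > 0 \<longrightarrow> q * poly f b = p * poly f a \<longrightarrow>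
      \<bar>real_of_int b - \<gamma> * of_int a - \<delta>\<bar> < \<epsilon>" if "\<epsilon> > 0" for \<epsilon>
  proof -
    obtain A where A: "\<And>x y. x \<ge> A \<Longrightarrow> y \<ge> 0 \<Longrightarrow> poly g y = of_int p / of_int q * poly g x \<Longrightarrow> \<bar>y - \<gamma> * x - \<delta>\<bar> < \<epsilon>"
      using ev[OF \<open>\<epsilon> > 0\<close>] unfolding eventually_at_top_linorder by blast
    have "\<bar>real_of_int b - \<gamma> * of_int a - \<delta>\<bar> < \<epsilon>"
      if "a \<ge> \<lceil>A\<rceil>" "b > 0" and eq: "q * poly f b = p * poly f a" for a b
    proof (rule A)
      have "real_of_int q * of_int (poly f b) = of_int p * of_int (poly f a)"
        using eq by (simp flip: of_int_mult)
      then show "poly g (of_int b) = of_int p / of_int q * poly g (of_int a)"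
        using p by (simp add: gi field_simps)
    qed (use that in \<open>simp_all add: ceiling_le_iff\<close>)
    then show ?thesis by blast
  qed
  \<comment> \<open>An infinite set of positive integers is unbounded above.\<close>
  have unb: "\<exists>a\<in>?T. a \<ge> A" for A
  proof (rule ccontr)
    assume "\<not> (\<exists>a\<in>?T. a \<ge> A)"
    then have "?T \<subseteq> {0..A}" by (auto simp: ratio_solutions_def)
    then show False using inf finite_subset by blast
  qed
  \<comment> \<open>Subtracting the estimates at \<open>a\<close> and \<open>a + k\<close> cancels
    \<open>\<delta>\<close>, so the integer \<open>b' - b\<close> approximates
    \<open>\<gamma> * k\<close>.\<close>
  have "\<exists>n :: int. \<bar>real_of_int n - \<gamma> * of_int k\<bar> < \<epsilon>" if "\<epsilon> > 0" for \<epsilon>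
  proof -
    obtain A where A: "\<And>a b. a \<ge> A \<Longrightarrow> b > 0 \<Longrightarrow> q * poly f b = p * poly f a \<Longrightarrow>
      \<bar>real_of_int b - \<gamma> * of_int a - \<delta>\<bar> < \<epsilon> / 2" using near[OF half_gt_zero[OF \<open>\<epsilon> > 0\<close>]] by blast
    obtain a where "a \<in> ?T" "a \<ge> A" using unb by blast
    then obtain b b' where "b > 0" "q * poly f b = p * poly f a" "b' > 0" "q * poly f b' = p * poly f (a + k)"
      by (auto simp: ratio_solutions_def)
    with A[of a b] A[of "a + k" b'] \<open>a \<ge> A\<close> k
    have "\<bar>real_of_int b - \<gamma> * of_int a - \<delta>\<bar> < \<epsilon> / 2" "\<bar>real_of_int b' - \<gamma> * of_int (a + k) - \<delta>\<bar> < \<epsilon> / 2"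
      by auto
    then have "\<bar>real_of_int (b' - b) - \<gamma> * of_int k\<bar> < \<epsilon>"
      unfolding of_int_add of_int_diff distrib_left by linarith
    then show ?thesis by blast
  qed
  then obtain l :: int where l: "\<gamma> * of_int k = of_int l" using approximable_by_int_imp_Ints by blast
  \<comment> \<open>Multiplication by \<open>k\<close> clears the denominator of
    \<open>\<gamma>\<close>, so that \<open>\<delta>\<close> times \<open>k\<close> becomes a limit
    of integers as well.\<close>
  have scale: "real_of_int (k * b - l * a) - of_int k * \<delta> = of_int k * (of_int b - \<gamma> * of_int a - \<delta>)" for a b
    by (simp add: l[symmetric] algebra_simps)
  have near': "\<exists>A. \<forall>a b. a \<ge> A \<longrightarrow> b > 0 \<longrightarrow> q * poly f b = p * poly f a \<longrightarrow>
      \<bar>real_of_int (k * b - l * a) - of_int k * \<delta>\<bar> < \<epsilon>" if "\<epsilon> > 0" for \<epsilon>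
  proof -
    have "\<epsilon> / of_int k > 0" using that k by simp
    from near[OF this] show ?thesis
      unfolding scale abs_mult using k by (simp add: field_simps)
  qed
  have "\<exists>n :: int. \<bar>real_of_int n - of_int k * \<delta>\<bar> < \<epsilon>" if "\<epsilon> > 0" for \<epsilon>
  proof -
    obtain A where A: "\<And>a b. a \<ge> A \<Longrightarrow> b > 0 \<Longrightarrow> q * poly f b = p * poly f a \<Longrightarrow>
      \<bar>real_of_int (k * b - l * a) - of_int k * \<delta>\<bar> < \<epsilon>" using near'[OF \<open>\<epsilon> > 0\<close>] by blast
    obtain a where "a \<in> ?T" "a \<ge> A" using unb by blast
    then obtain b where "b > 0" "q * poly f b = p * poly f a" by (auto simp: ratio_solutions_def)
    from A[OF \<open>a \<ge> A\<close> this] show ?thesis by blast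
  qed
  then obtain j :: int where j: "of_int k * \<delta> = of_int j" using approximable_by_int_imp_Ints by blast
  \<comment> \<open>Tolerance 1 suffices: integers at distance less than 1 coincide, which makes the
    affine relation exact.\<close>
  obtain A where A: "\<And>a b. a \<ge> A \<Longrightarrow> b > 0 \<Longrightarrow> q * poly f b = p * poly f a \<Longrightarrow>
      \<bar>real_of_int (k * b - l * a) - of_int j\<bar> < 1" using near'[of 1] unfolding j by auto
  have exact: "k * b = l * a + j" if "a \<ge> A" "b > 0" "q * poly f b = p * poly f a" for a b
    using A[OF that] by linarith
  \<comment> \<open>From here on the argument takes place in \<open>'a\<close>: \<open>r\<close> and
    \<open>e\<close> are the images of \<open>\<gamma>\<close> and \<open>\<delta>\<close>, now
    known to be \<open>l / k\<close> and \<open>j / k\<close>.\<close>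
  define h where "h = map_poly (of_int :: int \<Rightarrow> 'a) f"
  define r where "r = (of_int l / of_int k :: rat)"
  define e where "e = (of_int j / of_int k :: 'a)"
  have l0: "l > 0" "l < k"
  proof -
    have "\<gamma> * of_int k > 0" "\<gamma> * of_int k < of_int k" using \<gamma> \<gamma>1 k by simp_all
    then show "l > 0" "l < k" unfolding l by simp_all
  qed
  have r: "0 < r" "r < 1" using l0 k by (simp_all add: r_def)
  \<comment> \<open>\<open>P\<close> vanishes at every large \<open>a\<close> in the gap set, hence
    identically; so the map \<open>z \<mapsto> r * z + e\<close> preserves the roots of
    \<open>h\<close>.\<close>
  define P where "P = smult (of_int q) (pcompose h [:e, of_rat r:]) - smult (of_int p) h"
  have "P = 0"
  proof (rule ccontr)
    assume "P \<noteq> 0"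
    have "poly P (of_int a) = 0" if a: "a \<in> ?T" "a \<ge> A" for a
    proof -
      obtain b where b: "b > 0" "q * poly f b = p * poly f a" using a by (auto simp: ratio_solutions_def)
      have "of_int k * of_int b = (of_int l * of_int a + of_int j :: 'a)"
        using exact[OF a(2) b] by (metis of_int_add of_int_mult)
      then have "of_int b = (of_rat r * of_int a + e :: 'a)"
        using k by (simp add: r_def e_def of_rat_divide field_simps)
      then have "poly P (of_int a) = of_int q * poly h (of_int b) - of_int p * poly h (of_int a)"
        by (simp add: P_def poly_pcompose algebra_simps)
      also have "\<dots> = of_int (q * poly f b - p * poly f a)"
        by (simp add: h_def poly_map_of_int)
      finally show ?thesis using b by simp
    qed
    moreover have "?T - {0..A} \<subseteq> {a \<in> ?T. a \<ge> A}" by (auto simp: ratio_solutions_def)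
    ultimately have "of_int ` (?T - {0..A}) \<subseteq> {z. poly P z = 0}" by blast
    then have "finite ((of_int :: int \<Rightarrow> 'a) ` (?T - {0..A}))"
      using poly_roots_finite[OF \<open>P \<noteq> 0\<close>] finite_subset by blast
    then have "finite (?T - {0..A})"
      by (rule finite_imageD) (simp add: inj_on_def)
    then show False using inf by simp
  qed
  have "poly h (of_rat r * z + e) = 0" if "poly h z = 0" for z
  proof -
    have "poly P z = 0" using \<open>P = 0\<close> by simp
    then show ?thesis using that p by (simp add: P_def poly_pcompose algebra_simps)
  qed
  moreover have "h \<noteq> 0"
  proof -
    have "Polynomial.degree h > 0" using deg by (simp add: h_def degree_map_poly)
    then show ?thesis by auto
  qed
  ultimately have "z = e / (1 - of_rat r)" if "poly h z = 0" for z
    using affine_invariant_poly_root[of h r e z] r that by blast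
  then show False using roots unfolding h_def by blast
qed

section \<open>Sets of integers of density zero\<close>

definition zero_density :: "int set \<Rightarrow> bool" where
  "zero_density S \<longleftrightarrow> (\<lambda>N. real (card (S \<inter> {1..int N})) / real N) \<longlonglongrightarrow> 0"

text \<open>For any \<open>K\<close>, deleting the finite set \<open>U\<close> of elements followed
  by another at distance less than \<open>K\<close> leaves at most one element in each block of
  \<open>K\<close> consecutive integers, so the density is at most \<open>1 / K\<close>.\<close>

lemma zero_density_if_finite_gaps:
  assumes gaps: "\<And>k. k > 0 \<Longrightarrow> finite {a \<in> S. a + k \<in> S}"
  shows "zero_density S"
  unfolding zero_density_def
proof (rule tendstoI)
  fix \<epsilon> :: real assume "\<epsilon> > 0"
  obtain K :: nat where K: "K > 0" "1 / real K < \<epsilon> / 2"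
    using real_arch_inverse[of "\<epsilon> / 2"] \<open>\<epsilon> > 0\<close> by (auto simp: field_simps)
  define U where "U = (\<Union>k\<in>{0<..<int K}. {a \<in> S. a + k \<in> S})"
  have U: "finite U" unfolding U_def using gaps by auto
  have inj: "inj_on (\<lambda>a. a div int K) (S - U)"
  proof -
    have "False" if a: "a \<in> S" "a \<notin> U" "a' \<in> S" "a div int K = a' div int K" "a < a'" for a a'
    proof -
      have "a' - a = a' mod int K - a mod int K"
        using a(4) by (metis add_diff_cancel_left mult_div_mod_eq)
      moreover have "a' mod int K < int K" "a mod int K \<ge> 0" using K by simp_all
      ultimately have "a' - a \<in> {0<..<int K}" using a(5) by simp
      moreover have "a + (a' - a) \<in> S" using a by simp
      ultimately have "a \<in> U" unfolding U_def using a(1) by blast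
      then show False using a by simp
    qed
    then show ?thesis unfolding inj_on_def by (metis DiffE linorder_neqE)
  qed
  have bound: "real (card (S \<inter> {1..int N})) \<le> real (card U) + 1 + real N / real K" for N
  proof -
    have "card ((S - U) \<inter> {1..int N}) = card ((\<lambda>a. a div int K) ` ((S - U) \<inter> {1..int N}))"
      by (rule card_image[symmetric], rule inj_on_subset[OF inj]) auto
    \<comment> \<open>The quotient by \<open>K\<close> is the index of the block; block 0 accounts
      for the extra 1 in the count.\<close>
    also have "\<dots> \<le> card {0..int (N div K)}"
    proof (rule card_mono)
      show "(\<lambda>a. a div int K) ` ((S - U) \<inter> {1..int N}) \<subseteq> {0..int (N div K)}"
        using K by (auto simp: zdiv_int pos_imp_zdiv_nonneg_iff intro!: zdiv_mono1)
    qed simp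
    also have "\<dots> = N div K + 1" by simp
    finally have 1: "card ((S - U) \<inter> {1..int N}) \<le> N div K + 1" .
    have "card (S \<inter> {1..int N}) \<le> card (U \<union> (S - U) \<inter> {1..int N})"
      using U by (intro card_mono) auto
    also have "\<dots> \<le> card U + card ((S - U) \<inter> {1..int N})" by (rule card_Un_le)
    finally have "card (S \<inter> {1..int N}) \<le> card U + 1 + N div K" using 1 by simp
    then have "real (card (S \<inter> {1..int N})) \<le> real (card U + 1 + N div K)" by (rule of_nat_mono)
    also have "\<dots> \<le> real (card U) + 1 + real N / real K"
      using of_nat_div_le_of_nat[of N K, where ?'a = real] by simp
    finally show ?thesis .
  qed
  have "(\<lambda>N. (real (card U) + 1) / real N) \<longlonglongrightarrow> 0" by (rule lim_const_over_n)
  then have "eventually (\<lambda>N. (real (card U) + 1) / real N < \<epsilon> / 2) sequentially"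
    by (rule order_tendstoD(2)) (use \<open>\<epsilon> > 0\<close> in simp)
  with eventually_gt_at_top[of 0]
  show "eventually (\<lambda>N. dist (real (card (S \<inter> {1..int N})) / real N) 0 < \<epsilon>) sequentially"
  proof eventually_elim
    case (elim N)
    have "real (card (S \<inter> {1..int N})) / real N \<le> (real (card U) + 1 + real N / real K) / real N"
      using bound by (intro divide_right_mono) auto
    also have "\<dots> = (real (card U) + 1) / real N + 1 / real K"
      using elim by (simp add: add_divide_distrib)
    also have "\<dots> < \<epsilon>" using elim K by linarith
    finally show ?case by simp
  qed
qed

lemma zero_density_finite: "finite S \<Longrightarrow> zero_density S"
  by (rule zero_density_if_finite_gaps) auto

lemma zero_density_Un:
  assumes "zero_density S" and "zero_density T"
  shows "zero_density (S \<union> T)"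
proof -
  have lim: "(\<lambda>N. real (card (S \<inter> {1..int N})) / real N + real (card (T \<inter> {1..int N})) / real N) \<longlonglongrightarrow> 0"
    using tendsto_add[OF assms[unfolded zero_density_def]] by simp
  have "real (card ((S \<union> T) \<inter> {1..int N})) / real N
      \<le> real (card (S \<inter> {1..int N})) / real N + real (card (T \<inter> {1..int N})) / real N" for N
    using card_Un_le[of "S \<inter> {1..int N}" "T \<inter> {1..int N}"]
    by (auto simp: Int_Un_distrib2 add_divide_distrib[symmetric] intro!: divide_right_mono)
  then show ?thesis unfolding zero_density_def
    by (intro tendsto_sandwich[OF _ _ tendsto_const lim]) (auto intro!: always_eventually)
qed

lemma zero_density_UN:
  assumes "finite I" and "\<And>i. i \<in> I \<Longrightarrow> zero_density (S i)"
  shows "zero_density (\<Union>i\<in>I. S i)"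
  using assms by (induction I rule: finite_induct) (auto intro: zero_density_Un zero_density_finite)

section \<open>Counting integers divisible by a large square\<close>

lemma card_multiples_le:
  fixes d :: int
  assumes "d > 0"
  shows "real (card {h \<in> {1..int N}. d dvd h}) \<le> real N / of_int d"
proof -
  have "card {h \<in> {1..int N}. d dvd h} \<le> card {1..int N div d}"
  proof (rule card_inj_on_le[where f = "\<lambda>h. h div d"])
    show "inj_on (\<lambda>h. h div d) {h \<in> {1..int N}. d dvd h}"
      using assms by (auto simp: inj_on_def elim!: dvdE)
    show "(\<lambda>h. h div d) ` {h \<in> {1..int N}. d dvd h} \<subseteq> {1..int N div d}"
    proof clarify
      fix h assume h: "h \<in> {1..int N}" "d dvd h"
      then have "h div d \<le> int N div d" using assms by (intro zdiv_mono1) auto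
      moreover have "d \<le> h" using h by (auto intro: zdvd_imp_le)
      then have "1 \<le> h div d" using assms by (simp add: int_one_le_iff_zero_less pos_imp_zdiv_pos_iff)
      ultimately show "h div d \<in> {1..int N div d}" by simp
    qed
  qed simp
  also have "\<dots> = nat (int N div d)" by simp
  finally have "real (card {h \<in> {1..int N}. d dvd h}) \<le> real (nat (int N div d))" by simp
  also have "\<dots> = of_int (int N div d)" using assms by (simp add: pos_imp_zdiv_nonneg_iff)
  also have "\<dots> \<le> real N / of_int d" using real_of_int_div4[of "int N" d] by simp
  finally show ?thesis .
qed

text \<open>Telescoping with \<open>1 / (x + 1)\<^sup>2 \<le> 1 / x - 1 / (x + 1)\<close>; the
  subtracted term carries the induction.\<close>

lemma sum_inverse_squares_le:
  fixes Q n :: nat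
  assumes "Q \<ge> 1"
  shows "(\<Sum>q\<in>{Q<..Q + n}. 1 / (real q)\<^sup>2) \<le> 1 / real Q - 1 / real (Q + n)"
proof (induction n)
  case (Suc n)
  define x where "x = real (Q + n)"
  have x: "x > 0" using assms by (simp add: x_def)
  have "{Q<..Q + Suc n} = insert (Q + Suc n) {Q<..Q + n}" by auto
  then have "(\<Sum>q\<in>{Q<..Q + Suc n}. 1 / (real q)\<^sup>2) = 1 / (x + 1)\<^sup>2 + (\<Sum>q\<in>{Q<..Q + n}. 1 / (real q)\<^sup>2)"
    by (simp add: x_def add_ac)
  also have "\<dots> \<le> 1 / (x + 1)\<^sup>2 + (1 / real Q - 1 / x)" using Suc x_def by simp
  also have "1 / (x + 1)\<^sup>2 \<le> 1 / x - 1 / (x + 1)"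
  proof -
    have "1 / x - 1 / (x + 1) = 1 / (x * (x + 1))" using x by (simp add: field_simps)
    moreover have "1 / (x + 1)\<^sup>2 \<le> 1 / (x * (x + 1))"
      using x by (intro divide_left_mono) (auto simp: power2_eq_square)
    ultimately show ?thesis by simp
  qed
  finally show ?case by (simp add: x_def add_ac)
qed simp

text \<open>Union bound: each \<open>q\<close> contributes at most \<open>N / q\<^sup>2\<close>, and
  the tail of the inverse squares beyond \<open>Q\<close> is at most \<open>1 / Q\<close>.\<close>

lemma card_square_multiples_le:
  assumes "Q \<ge> 1"
  shows "real (card {h \<in> {1..int N}. \<exists>q>int Q. q\<^sup>2 dvd h}) \<le> real N / real Q"
proof -
  let ?B = "\<lambda>q. {h \<in> {1..int N}. (int q)\<^sup>2 dvd h}"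
  have "{h \<in> {1..int N}. \<exists>q>int Q. q\<^sup>2 dvd h} \<subseteq> (\<Union>q\<in>{Q<..Q + N}. ?B q)"
  proof clarify
    fix h q assume h: "h \<in> {1..int N}" "q > int Q" "q\<^sup>2 dvd h"
    \<comment> \<open>A divisor \<open>q\<^sup>2\<close> of \<open>h \<le> N\<close> has
      \<open>q \<le> N\<close>, so the union is finite; the limit \<open>Q + N\<close> fits the form
      of the telescoped sum.\<close>
    have "q \<le> q\<^sup>2" using h(2) by (intro self_le_power) auto
    also have "q\<^sup>2 \<le> h" using h by (auto intro: zdvd_imp_le)
    finally have "nat q \<in> {Q<..Q + N}" "int (nat q) = q" using h by auto
    then show "h \<in> (\<Union>q\<in>{Q<..Q + N}. ?B q)" using h by (intro UN_I[of "nat q"]) simp_all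
  qed
  moreover have "finite (?B q)" for q
    by (rule finite_subset[of _ "{1..int N}"]) auto
  ultimately have "card {h \<in> {1..int N}. \<exists>q>int Q. q\<^sup>2 dvd h} \<le> card (\<Union>q\<in>{Q<..Q + N}. ?B q)"
    by (intro card_mono finite_UN_I) (rule finite_greaterThanAtMost)
  also have "\<dots> \<le> (\<Sum>q\<in>{Q<..Q + N}. card (?B q))" by (rule card_UN_le) simp
  finally have "real (card {h \<in> {1..int N}. \<exists>q>int Q. q\<^sup>2 dvd h}) \<le> (\<Sum>q\<in>{Q<..Q + N}. real (card (?B q)))"
    unfolding of_nat_sum[symmetric] by (rule of_nat_mono)
  also have "\<dots> \<le> (\<Sum>q\<in>{Q<..Q + N}. real N * (1 / (real q)\<^sup>2))"
  proof (rule sum_mono)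
    fix q assume "q \<in> {Q<..Q + N}"
    then show "real (card (?B q)) \<le> real N * (1 / (real q)\<^sup>2)"
      using card_multiples_le[of "(int q)\<^sup>2" N] by simp
  qed
  also have "\<dots> = real N * (\<Sum>q\<in>{Q<..Q + N}. 1 / (real q)\<^sup>2)" by (simp add: sum_distrib_left)
  also have "\<dots> \<le> real N * (1 / real Q)"
  proof (rule mult_left_mono)
    have "1 / real (Q + N) \<ge> 0" by simp
    then show "(\<Sum>q\<in>{Q<..Q + N}. 1 / (real q)\<^sup>2) \<le> 1 / real Q"
      using sum_inverse_squares_le[OF assms, of N] by linarith
  qed simp
  finally show ?thesis by simp
qed

section \<open>Invisible points and the density of visible ones\<close>

text \<open>As \<open>f ^ m\<close> is nonzero at \<open>a\<close>, the only candidate for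
  \<open>t\<close> is \<open>h\<close> divided by its value there. Invisibility then yields a
  smaller \<open>u\<close> with \<open>h * poly f u ^ m = n * poly f a ^ m\<close>; cancelling the
  gcd leaves coprime \<open>p\<close>, \<open>q\<close> with \<open>q ^ m\<close> dividing
  \<open>h\<close>.\<close>

lemma invisible_imp_ratio_solution:
  fixes f :: "int poly"
  assumes a: "a > 0" and h: "h > 0" and m: "m \<ge> 2"
    and fa: "poly f a > 0" and dom: "\<And>u. 0 < u \<Longrightarrow> u < a \<Longrightarrow> \<bar>poly f u\<bar> < poly f a"
    and inv: "\<not> visible_along (f ^ m) (a, h)"
  obtains p q where "p \<noteq> 0" "\<bar>p\<bar> < q" "q\<^sup>2 dvd h" "a \<in> ratio_solutions f p q"
proof -
  define t where "t = (of_int h / of_int (poly (f ^ m) a) :: rat)"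
  have Fa: "poly (f ^ m) a > 0" using fa by (simp add: poly_power)
  have t: "of_int h = t * of_int (poly (f ^ m) a)"
    using Fa unfolding t_def by (metis less_irrefl nonzero_divide_eq_eq of_int_eq_0_iff)
  have "pos_int_value (f ^ m) t a"
    unfolding pos_int_value_def t[symmetric] using h by simp
  then obtain u where u: "u > 0" "u < a" "pos_int_value (f ^ m) t u"
    using inv a h t unfolding visible_along_def by (auto simp: not_le)
  then obtain n where n: "t * of_int (poly (f ^ m) u) = of_int n" "n \<noteq> 0"
    unfolding pos_int_value_def by (auto elim!: Ints_cases)
  have "of_int h * of_int (poly (f ^ m) u) = (of_int n * of_int (poly (f ^ m) a) :: rat)"
    unfolding t using n by (simp add: algebra_simps)
  then have "h * poly (f ^ m) u = n * poly (f ^ m) a"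
    by (simp only: of_int_mult[symmetric] of_int_eq_iff)
  then have eq: "h * poly f u ^ m = n * poly f a ^ m" by (simp add: poly_power)
  have fu: "poly f u \<noteq> 0"
    using eq n(2) fa m by (auto simp: power_0_left)
  define g where "g = gcd (poly f u) (poly f a)"
  have g: "g > 0" using fa by (simp add: g_def)
  obtain p q where pq: "poly f u = p * g" "poly f a = q * g" "coprime p q"
    using gcd_coprime_exists[of "poly f u" "poly f a", folded g_def] g by blast
  have "h * p ^ m * g ^ m = n * q ^ m * g ^ m"
    using eq unfolding pq by (simp add: power_mult_distrib mult_ac)
  then have "h * p ^ m = n * q ^ m" using g by simp
  then have "q ^ m dvd h * p ^ m" by simp
  moreover have "coprime (q ^ m) (p ^ m)" using pq(3) by (simp add: coprime_commute)
  ultimately have "q ^ m dvd h" by (simp add: coprime_dvd_mult_left_iff)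
  \<comment> \<open>Here \<open>m \<ge> 2\<close> enters: it supplies a square divisor, and inverse
    squares are summable.\<close>
  then have "q\<^sup>2 dvd h" using m power_le_dvd by blast
  moreover have "p \<noteq> 0" using fu pq by auto
  moreover have "\<bar>p\<bar> < q"
  proof -
    have "\<bar>p\<bar> * g < q * g" using dom[OF u(1,2)] g unfolding pq by (simp add: abs_mult)
    then show ?thesis using g by simp
  qed
  moreover have "a \<in> ratio_solutions f p q"
    using a u(1) pq by (auto simp: ratio_solutions_def intro!: exI[of _ u])
  ultimately show ?thesis using that by blast
qed

theorem theorem1p2:
  fixes f F :: "int poly" and m :: nat
  assumes "Polynomial.degree f \<ge> 2"
    and "Polynomial.lead_coeff f > 0"
    and "\<exists>x y :: rat alg_closure. x \<noteq> y \<and>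
           poly (map_poly of_int f) x = 0 \<and> poly (map_poly of_int f) y = 0"
    and "m \<ge> 2"
    and "F = f ^ m"
  shows "has_lattice_density {p. visible_along F p} 1"
proof -
  have deg: "Polynomial.degree f > 0" using assms(1) by simp
  \<comment> \<open>Visible and invisible points partition the square of side \<open>N\<close>, so
    it suffices that the invisible ones number \<open>o(N\<^sup>2)\<close>.\<close>
  define V where "V N = {(a, h). a > 0 \<and> h > 0 \<and> max a h \<le> int N \<and> visible_along F (a, h)}" for N
  define W where "W N = {(a, h). a > 0 \<and> h > 0 \<and> max a h \<le> int N \<and> \<not> visible_along F (a, h)}" for N
  have square: "V N \<union> W N = {1..int N} \<times> {1..int N}" for N by (auto simp: V_def W_def)
  have fin: "finite (V N)" "finite (W N)" for N
    by (rule finite_subset[of _ "{1..int N} \<times> {1..int N}"]; auto simp: V_def W_def)+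
  have V: "real (card (V N)) = real N ^ 2 - real (card (W N))" for N
  proof -
    have "card (V N) + card (W N) = card (V N \<union> W N)"
      by (rule card_Un_disjoint[symmetric]) (use fin in \<open>auto simp: V_def W_def\<close>)
    also have "\<dots> = N ^ 2" unfolding square by (simp add: power2_eq_square)
    finally have "real (card (V N) + card (W N)) = real (N ^ 2)" by (rule arg_cong)
    then show ?thesis by simp
  qed
  have sol: "zero_density (ratio_solutions f p q)" if "p \<noteq> 0" "\<bar>p\<bar> < q" for p q
  proof (cases "p > 0")
    case True
    then show ?thesis
      using assms(2,3) deg that finite_ratio_solutions_gap[of f _ _ p q]
      by (intro zero_density_if_finite_gaps) (auto simp: abs_less_iff)
  next
    case False
    then show ?thesis
      using assms(2) deg that by (intro zero_density_finite finite_ratio_solutions_neg) auto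
  qed
  obtain A :: int where A: "A > 0" "\<And>a u. a \<ge> A \<Longrightarrow> 0 \<le> u \<Longrightarrow> u < a \<Longrightarrow> \<bar>poly f u\<bar> < poly f a"
  proof -
    define g where "g = map_poly real_of_int f"
    have dg: "Polynomial.degree g > 0" "Polynomial.lead_coeff g > 0"
      using deg assms(2) by (simp_all add: g_def degree_map_poly coeff_map_poly)
    obtain Y where Y: "\<And>x y. y \<ge> Y \<Longrightarrow> 0 \<le> x \<Longrightarrow> x < y \<Longrightarrow> \<bar>poly g x\<bar> < poly g y"
      using eventually_poly_dominates[OF dg] unfolding eventually_at_top_linorder by blast
    show ?thesis
    proof (rule that[of "max 1 \<lceil>Y\<rceil>"])
      fix a u assume "a \<ge> max 1 \<lceil>Y\<rceil>" "0 \<le> u" "u < a"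
      then have "\<bar>poly g (of_int u)\<bar> < poly g (of_int a)"
        by (intro Y) (auto simp: ceiling_le_iff)
      then show "\<bar>poly f u\<bar> < poly f a" by (simp add: g_def poly_map_of_int flip: of_int_abs)
    qed simp
  qed
  have "(\<lambda>N. real (card (W N)) / real N ^ 2) \<longlonglongrightarrow> 0"
  proof (rule tendstoI)
    fix \<epsilon> :: real assume "\<epsilon> > 0"
    \<comment> \<open>Half of \<open>\<epsilon>\<close> pays for denominators above
      \<open>Q\<close>, the other half for the finitely many ratios with denominator at most
      \<open>Q\<close>.\<close>
    obtain Q :: nat where Q: "Q \<ge> 1" "1 / real Q < \<epsilon> / 2"
      using real_arch_inverse[of "\<epsilon> / 2"] \<open>\<epsilon> > 0\<close> by (auto simp: field_simps Suc_le_eq)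
    define I where "I = {(p, q). p \<noteq> 0 \<and> \<bar>p\<bar> < q \<and> q \<le> int Q}"
    have "I \<subseteq> {- int Q..int Q} \<times> {0..int Q}" by (auto simp: I_def)
    then have I: "finite I" by (rule finite_subset) simp
    define E where "E = {1..A} \<union> (\<Union>(p, q)\<in>I. ratio_solutions f p q)"
    have "zero_density E" unfolding E_def
      by (intro zero_density_Un[OF zero_density_finite] zero_density_UN I) (auto simp: I_def intro: sol)
    define T where "T N = {h \<in> {1..int N}. \<exists>q>int Q. q\<^sup>2 dvd h}" for N
    have T: "finite (T N)" for N
      by (rule finite_subset[of _ "{1..int N}"]) (auto simp: T_def)
    \<comment> \<open>An invisible point has an exceptional abscissa, in \<open>E\<close>, or an
      exceptional ordinate, in \<open>T N\<close>.\<close>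
    have W: "W N \<subseteq> (E \<inter> {1..int N}) \<times> {1..int N} \<union> {1..int N} \<times> T N" for N
    proof (rule subrelI, rule UnCI)
      fix a h assume ah: "(a, h) \<in> W N" and nT: "(a, h) \<notin> {1..int N} \<times> T N"
      have N: "a \<in> {1..int N}" "h \<in> {1..int N}" using ah by (auto simp: W_def)
      have "a \<in> E"
      proof (cases "a \<le> A")
        case False
        \<comment> \<open>Domination over the value at 0 already forces positivity, as an absolute
          value lies below \<open>poly f a\<close>.\<close>
        have "poly f a > 0" using A(2)[of a 0] False A(1) by force
        moreover have "\<bar>poly f u\<bar> < poly f a" if "0 < u" "u < a" for u
          using A(2)[of a u] that False by simp
        moreover have "\<not> visible_along (f ^ m) (a, h)" using ah assms(5) by (simp add: W_def)
        moreover have "a > 0" "h > 0" using N by simp_all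
        ultimately obtain p q where pq: "p \<noteq> 0" "\<bar>p\<bar> < q" "q\<^sup>2 dvd h" "a \<in> ratio_solutions f p q"
          using invisible_imp_ratio_solution assms(4) by blast
        then have "q \<le> int Q" using nT N unfolding T_def by force
        then show ?thesis using pq by (auto simp: E_def I_def)
      qed (use N in \<open>auto simp: E_def\<close>)
      then show "(a, h) \<in> (E \<inter> {1..int N}) \<times> {1..int N}" using N by blast
    qed
    have bound: "real (card (W N)) \<le> real (card (E \<inter> {1..int N})) * real N + real N * (real N / real Q)" for N
    proof -
      have "card (W N) \<le> card ((E \<inter> {1..int N}) \<times> {1..int N} \<union> {1..int N} \<times> T N)"
        by (rule card_mono[OF _ W]) (simp add: T)
      also have "\<dots> \<le> card ((E \<inter> {1..int N}) \<times> {1..int N}) + card ({1..int N} \<times> T N)"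
        by (rule card_Un_le)
      also have "\<dots> = card (E \<inter> {1..int N}) * N + N * card (T N)" by (simp add: card_cartesian_product)
      finally have "real (card (W N)) \<le> real (card (E \<inter> {1..int N}) * N + N * card (T N))" by (rule of_nat_mono)
      also have "\<dots> \<le> real (card (E \<inter> {1..int N})) * real N + real N * (real N / real Q)"
        using mult_left_mono[OF card_square_multiples_le[OF Q(1), of N], of "real N"] by (simp add: T_def)
      finally show ?thesis .
    qed
    have "eventually (\<lambda>N. real (card (E \<inter> {1..int N})) / real N < \<epsilon> / 2) sequentially"
      using \<open>zero_density E\<close> \<open>\<epsilon> > 0\<close> unfolding zero_density_def by (intro order_tendstoD(2)) auto
    with eventually_gt_at_top[of 0]
    show "eventually (\<lambda>N. dist (real (card (W N)) / real N ^ 2) 0 < \<epsilon>) sequentially"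
    proof eventually_elim
      case (elim N)
      have "real (card (W N)) / real N ^ 2
          \<le> (real (card (E \<inter> {1..int N})) * real N + real N * (real N / real Q)) / real N ^ 2"
        using bound by (intro divide_right_mono) auto
      also have "\<dots> = real (card (E \<inter> {1..int N})) / real N + 1 / real Q"
        using elim by (simp add: add_divide_distrib power2_eq_square)
      also have "\<dots> < \<epsilon>" using elim Q by linarith
      finally show ?case by simp
    qed
  qed
  then have "(\<lambda>N. 1 - real (card (W N)) / real N ^ 2) \<longlonglongrightarrow> 1 - 0"
    by (intro tendsto_intros)
  \<comment> \<open>Only eventual equality holds: at \<open>N = 0\<close> division by zero makes the
    right side 0 and the left side 1.\<close>
  moreover have "eventually (\<lambda>N. 1 - real (card (W N)) / real N ^ 2 = real (card (V N)) / real N ^ 2) sequentially"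
    using eventually_gt_at_top[of 0] by eventually_elim (simp add: V diff_divide_distrib)
  ultimately have "(\<lambda>N. real (card (V N)) / real N ^ 2) \<longlonglongrightarrow> 1"
    unfolding diff_zero by (rule Lim_transform_eventually)
  then show ?thesis by (simp add: has_lattice_density_def V_def)
qed

end
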